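(* Let $n,T\ge1$ be integers, $\epsilon\in\mathbb{R}$ with $\epsilon\neq1$, $c_1,\dots,c_n\in\mathbb{R}$, $W\in\mathbb{R}^{n\times n}$, integers $0\le\tau_{ij}\le T-1$ for $1\le i,j\le n$, and for $1\le i\le n$ let $\phi_i:\mathbb{R}\to\mathbb{R}$ be a smooth function with Lipschitz constant $\mathcal{L}\geq 0$. Let $(\mathcal{H},\mathbb{R}^{nT})$ be the time-delayed Cohen-Grossberg network $$\mathcal{H}_j(\mathbf{x}^k,\dots,\mathbf{x}^{k-(T-1)})=(1-\epsilon)x_j^{k-\tau_{jj}}+\sum_{i=1}^nW_{ij}\phi_i\big(x_i^{k-\tau_{ij}}\big)+c_j,\qquad 1\le j\le n.$$ If $|1-\epsilon|+\mathcal{L}\,\rho(|W|)<1$, then $(\mathcal{H},\mathbb{R}^{nT})$ has a globally attracting fixed point.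
   Context: $|W|$ is the matrix with entries $|W|_{ij}=|W_{ij}|$ and $\rho$ is the spectral radius. The orbit of an initial condition $(\mathbf{x}^0,\mathbf{x}^{-1},\dots,\mathbf{x}^{-T+1})\in(\mathbb{R}^n)^T$ is the sequence $\{\mathbf{x}^k\}_{k>-T}$ in $\mathbb{R}^n$ with $\mathbf{x}^{k+1}=\mathcal{H}(\mathbf{x}^k,\mathbf{x}^{k-1},\dots,\mathbf{x}^{k-(T-1)})$ for $k\ge0$. A globally attracting fixed point is a point $\tilde{\mathbf{x}}\in\mathbb{R}^n$ with $\tilde{\mathbf{x}}=\mathcal{H}(\tilde{\mathbf{x}},\dots,\tilde{\mathbf{x}})$ such that $\lim_{k\to\infty}\max_i|x_i^k-\tilde x_i|=0$ for every initial condition. *)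

theory Defs
  imports "HOL-Analysis.Lipschitz" "Jordan_Normal_Form.Spectral_Radius"
begin

no_notation vec_nth (infixl "$" 90)

definition abs_mat :: "real mat \<Rightarrow> real mat" where
  "abs_mat A = map_mat (\<lambda>a. \<bar>a\<bar>) A"

text \<open>C-infinity: every iterated derivative exists and is itself differentiable everywhere.\<close>

definition smooth :: "(real \<Rightarrow> real) \<Rightarrow> bool" where
  "smooth f \<longleftrightarrow> (\<forall>m x. (deriv ^^ m) f differentiable (at x))"

text \<open>
  A point of $(R^n)^T$ is a list of $T$ vectors, most recent first: the entry with index $d$ is the
  state at delay $d$, so that a history at time $k$ is $[x^k, x^{k-1}, \ldots, x^{k-(T-1)}]$.
\<close>

definition histories :: "nat \<Rightarrow> nat \<Rightarrow> real vec list set" where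
  "histories n T = {xs. length xs = T \<and> set xs \<subseteq> carrier_vec n}"

text \<open>
  Only the values of \<open>x\<close> at times \<open>k > - T\<close> are constrained; values at earlier times are irrelevant.
\<close>

definition is_orbit ::
  "nat \<Rightarrow> (real vec list \<Rightarrow> real vec) \<Rightarrow> real vec list \<Rightarrow> (int \<Rightarrow> real vec) \<Rightarrow> bool" where
  "is_orbit T H ini x \<longleftrightarrow>
     (\<forall>d<T. x (- int d) = ini ! d) \<and>
     (\<forall>k\<ge>0. x (k + 1) = H (map (\<lambda>d. x (k - int d)) [0..<T]))"

definition globally_attracting_fixed_point ::
  "nat \<Rightarrow> nat \<Rightarrow> (real vec list \<Rightarrow> real vec) \<Rightarrow> real vec \<Rightarrow> bool" where
  "globally_attracting_fixed_point n T H p \<longleftrightarrow>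
     p \<in> carrier_vec n \<and>
     p = H (replicate T p) \<and>
     (\<forall>ini\<in>histories n T. \<forall>x. is_orbit T H ini x \<longrightarrow>
        (\<lambda>k. MAX i\<in>{..<n}. \<bar>x (int k) $ i - p $ i\<bar>) \<longlonglongrightarrow> 0)"

definition cohen_grossberg ::
  "nat \<Rightarrow> real \<Rightarrow> real mat \<Rightarrow> (nat \<Rightarrow> nat \<Rightarrow> nat) \<Rightarrow> (nat \<Rightarrow> real \<Rightarrow> real) \<Rightarrow> real vec
    \<Rightarrow> real vec list \<Rightarrow> real vec" where
  "cohen_grossberg n \<epsilon> W \<tau> \<phi> c xs =
     vec n (\<lambda>j. (1 - \<epsilon>) * (xs ! \<tau> j j) $ j
       + (\<Sum>i<n. W $$ (i, j) * \<phi> i ((xs ! \<tau> i j) $ i)) + c $ j)"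

text \<open>Every initial condition has an orbit, so the attraction condition is never vacuous.\<close>

fun orbit_aux :: "nat \<Rightarrow> (real vec list \<Rightarrow> real vec) \<Rightarrow> real vec list \<Rightarrow> nat \<Rightarrow> real vec list" where
  "orbit_aux T H ini 0 = ini"
| "orbit_aux T H ini (Suc k) = H (orbit_aux T H ini k) # butlast (orbit_aux T H ini k)"

lemma ex_is_orbit:
  assumes "T \<ge> 1" "length ini = T"
  shows "\<exists>x. is_orbit T H ini x"
proof -
  define h where "h = orbit_aux T H ini"
  have h_Suc: "h (Suc k) = H (h k) # butlast (h k)" for k
    by (simp add: h_def)
  have h_0: "h 0 = ini"
    by (simp add: h_def)
  have len: "length (h k) = T" for k
    by (induction k) (use assms in \<open>auto simp: h_0 h_Suc\<close>)
  define x where "x k = (if k \<le> 0 then ini ! nat (- k) else hd (h (nat k)))" for k :: int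
  have entry: "h k ! d = x (int k - int d)" if "d < T" for k d
    using that
  proof (induction k arbitrary: d)
    case 0
    then show ?case by (simp add: x_def h_0)
  next
    case (Suc k)
    show ?case
    proof (cases d)
      case 0
      then show ?thesis by (simp add: x_def h_Suc nat_add_distrib)
    next
      case (Suc e)
      with Suc.prems have "e < T - 1" by simp
      then have "h (Suc k) ! d = h k ! e"
        by (simp add: h_Suc Suc nth_butlast len)
      also have "\<dots> = x (int k - int e)"
        using \<open>e < T - 1\<close> by (intro Suc.IH) simp
      finally show ?thesis by (simp add: Suc)
    qed
  qed
  have hist: "map (\<lambda>d. x (int k - int d)) [0..<T] = h k" for k
    by (rule nth_equalityI) (auto simp: len entry)
  have "x (k + 1) = H (map (\<lambda>d. x (k - int d)) [0..<T])" if "k \<ge> 0" for k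
  proof -
    define m where "m = nat k"
    have m: "k = int m" using that by (simp add: m_def)
    have "x (k + 1) = h (Suc m) ! 0"
      using entry[of 0 "Suc m"] assms by (simp add: m algebra_simps)
    then show ?thesis unfolding m hist by (simp add: h_Suc)
  qed
  then show ?thesis
    unfolding is_orbit_def by (intro exI[of _ x]) (auto simp: x_def)
qed

end

theory Submission
  imports Defs
begin

text \<open>
  A nonnegative matrix \<open>A\<close> with spectral radius below \<open>r\<close> has a positive weight vector \<open>v\<close> with
  \<open>v A \<le> r v\<close> entrywise (lemma \<open>positive_subinvariant_weight\<close>).  Apply this to \<open>A = |W|\<close> with
  some \<open>r > \<rho>(|W|)\<close> for which \<open>|1 - \<epsilon>| + L r\<close> is still below \<open>1\<close>, and measure a state by the
  weighted maximum norm \<open>max |x\<^sub>i| / v\<^sub>i\<close>.  In this norm the network contracts: if two histories are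
  at distance at most \<open>M\<close> at every delay, then their successors are at distance at most \<open>q M\<close>,
  for some \<open>q < 1\<close> (lemma \<open>cohen_grossberg_contracts\<close>).  The bound \<open>M\<close> covers the whole history, so the
  factor \<open>q\<close> is the same for every choice of delays.

  Iterating the contraction on constant histories gives a sequence with geometrically decreasing
  increments, whose limit is a fixed point \<open>p\<close>
  (lemma \<open>cohen_grossberg_has_fixed_point\<close>).  Along an orbit, the distance to \<open>p\<close> gains a
  factor \<open>q\<close> for every \<open>T\<close> steps, so it decays at least as fast as \<open>(root T q)^k\<close>
  (lemma \<open>delayed_contraction_decays\<close>).
\<close>

section \<open>A weight vector for a nonnegative matrix\<close>

text \<open>
  Rescaling by \<open>1 / r\<close> brings the spectral radius below \<open>1\<close>, where the powers of a matrix are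
  bounded.
\<close>

lemma power_entries_bounded_by_spectral_radius:
  fixes A :: "complex mat"
  assumes A: "A \<in> carrier_mat n n" and n: "n > 0" and r: "spectral_radius A < r"
  shows "\<exists>C. \<forall>k. norm_bound (A ^\<^sub>m k) (C * r ^ k)"
proof -
  have sr_nonneg: "0 \<le> spectral_radius A"
    using spectral_radius_mem_max(1)[OF A n] by auto
  then have r0: "r > 0" using r by simp
  define B where "B = complex_of_real (1 / r) \<cdot>\<^sub>m A"
  have B: "B \<in> carrier_mat n n" using A by (simp add: B_def)
  have AB: "A = complex_of_real r \<cdot>\<^sub>m B"
    using r0 by (intro eq_matI) (auto simp: B_def)
  have "spectral_radius B < 1"
  proof -
    obtain ev where ev: "ev \<in> spectrum B" and sr: "spectral_radius B = norm ev"
      using spectral_radius_mem_max(1)[OF B n] by auto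
    obtain w where w: "w \<in> carrier_vec n" "w \<noteq> 0\<^sub>v n" "B *\<^sub>v w = ev \<cdot>\<^sub>v w"
      using ev B unfolding spectrum_def eigenvalue_def eigenvector_def by auto
    have "A *\<^sub>v w = complex_of_real r \<cdot>\<^sub>v (B *\<^sub>v w)"
      unfolding AB using B w(1) by (intro eq_vecI) auto
    also have "\<dots> = (complex_of_real r * ev) \<cdot>\<^sub>v w"
      by (simp add: w(3) smult_smult_assoc)
    finally have "complex_of_real r * ev \<in> spectrum A"
      using w A unfolding spectrum_def eigenvalue_def eigenvector_def by auto
    then have "norm (complex_of_real r * ev) \<le> spectral_radius A"
      by (intro spectral_radius_mem_max(2)[OF A n]) auto
    then have "r * norm ev < r * 1"
      using r r0 by (simp only: norm_mult norm_of_real abs_of_pos mult_1_right)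
    then have "norm ev < 1" using r0 by (simp only: mult_less_cancel_left_pos)
    then show ?thesis using sr by simp
  qed
  from spectral_radius_jnf_norm_bound_less_1_upper_triangular[OF B this]
  obtain C where C: "\<And>k. norm_bound (B ^\<^sub>m k) C" by blast
  have pow: "A ^\<^sub>m k = complex_of_real (r ^ k) \<cdot>\<^sub>m B ^\<^sub>m k" for k
  proof (induction k)
    case 0
    show ?case using A B by (intro eq_matI) auto
  next
    case (Suc k)
    have Bk: "B ^\<^sub>m k \<in> carrier_mat n n" using B by simp
    have "A ^\<^sub>m Suc k = (complex_of_real (r ^ k) \<cdot>\<^sub>m B ^\<^sub>m k) * (complex_of_real r \<cdot>\<^sub>m B)"
      using Suc AB by simp
    also have "\<dots> = complex_of_real (r ^ k) \<cdot>\<^sub>m (B ^\<^sub>m k * (complex_of_real r \<cdot>\<^sub>m B))"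
      using B Bk by (intro mult_smult_assoc_mat) auto
    also have "B ^\<^sub>m k * (complex_of_real r \<cdot>\<^sub>m B) = complex_of_real r \<cdot>\<^sub>m (B ^\<^sub>m k * B)"
      using B Bk by (intro mult_smult_distrib)
    also have "complex_of_real (r ^ k) \<cdot>\<^sub>m \<dots> = complex_of_real (r ^ Suc k) \<cdot>\<^sub>m B ^\<^sub>m Suc k"
      using B Bk by (intro eq_matI) (auto simp: ac_simps)
    finally show ?case .
  qed
  have "norm_bound (A ^\<^sub>m k) (C * r ^ k)" for k
  proof
    fix i j assume ij: "i < dim_row (A ^\<^sub>m k)" "j < dim_col (A ^\<^sub>m k)"
    then have ijB: "i < dim_row (B ^\<^sub>m k)" "j < dim_col (B ^\<^sub>m k)"
      by (simp_all add: pow)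
    then have "norm ((A ^\<^sub>m k) $$ (i, j)) = r ^ k * norm ((B ^\<^sub>m k) $$ (i, j))"
      using r0 by (simp add: pow norm_mult norm_power)
    also have "\<dots> \<le> r ^ k * C"
      using C[of k] ijB r0 unfolding norm_bound_def by (intro mult_left_mono) auto
    finally show "norm ((A ^\<^sub>m k) $$ (i, j)) \<le> C * r ^ k" by (simp add: mult.commute)
  qed
  then show ?thesis by blast
qed

text \<open>
  With \<open>u\<^sub>k\<close> the row vector of column sums of \<open>(A / r)^k\<close>, the Neumann series \<open>v = \<Sum>k. u\<^sub>k\<close> would
  satisfy \<open>v (A / r) = v - u\<^sub>0\<close>.  A partial sum up to \<open>N\<close> is enough: it satisfies
  \<open>v (A / r) = v - u\<^sub>0 + u\<^sub>N\<close>, and \<open>u\<^sub>N \<le> u\<^sub>0\<close> for large \<open>N\<close> since the powers of \<open>A / r\<close> tend to zero.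
\<close>

lemma positive_subinvariant_weight:
  fixes A :: "real mat"
  assumes A: "A \<in> carrier_mat n n" and n: "n > 0"
    and nonneg: "\<And>i j. i < n \<Longrightarrow> j < n \<Longrightarrow> 0 \<le> A $$ (i, j)"
    and r: "spectral_radius (map_mat complex_of_real A) < r"
  shows "\<exists>v. \<forall>j<n. 1 \<le> v j \<and> (\<Sum>i<n. v i * A $$ (i, j)) \<le> r * v j"
proof -
  let ?Ac = "map_mat complex_of_real A"
  have Ac: "?Ac \<in> carrier_mat n n" using A by simp
  obtain r' where r': "spectral_radius ?Ac < r'" "r' < r" using dense[OF r] by blast
  have "0 \<le> spectral_radius ?Ac" using spectral_radius_mem_max(1)[OF Ac n] by auto
  then have r'0: "0 < r'" and r0: "0 < r" using r' by auto
  obtain C where C: "\<And>k. norm_bound (?Ac ^\<^sub>m k) (C * r' ^ k)"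
    using power_entries_bounded_by_spectral_radius[OF Ac n r'(1)] by blast
  have Ak: "A ^\<^sub>m k \<in> carrier_mat n n" for k using A by simp
  have entry: "\<bar>(A ^\<^sub>m k) $$ (i, j)\<bar> \<le> C * r' ^ k" if "i < n" "j < n" for i j k
  proof -
    have "?Ac ^\<^sub>m k = map_mat complex_of_real (A ^\<^sub>m k)"
      by (rule of_real_hom.mat_hom_pow[OF A, symmetric])
    then have "norm (complex_of_real ((A ^\<^sub>m k) $$ (i, j))) \<le> C * r' ^ k"
      using C[of k] that Ak[of k] A unfolding norm_bound_def by auto
    then show ?thesis by simp
  qed
  define u where "u k j = (\<Sum>i<n. (A ^\<^sub>m k) $$ (i, j)) / r ^ k" for k j
  have u_0: "u 0 j = 1" if "j < n" for j
    using that A by (simp add: u_def sum.delta' one_mat_def)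
  have u_Suc: "(\<Sum>i<n. u k i * A $$ (i, j)) = r * u (Suc k) j" if j: "j < n" for k j
  proof -
    have "(\<Sum>i<n. (A ^\<^sub>m Suc k) $$ (i, j)) = (\<Sum>l<n. \<Sum>i<n. (A ^\<^sub>m k) $$ (l, i) * A $$ (i, j))"
      using j A Ak[of k] by (intro sum.cong) (auto simp: scalar_prod_def atLeast0LessThan)
    also have "\<dots> = (\<Sum>i<n. (\<Sum>l<n. (A ^\<^sub>m k) $$ (l, i)) * A $$ (i, j))"
      by (subst sum.swap) (simp add: sum_distrib_right)
    finally show ?thesis using r0
      by (simp add: u_def sum_divide_distrib[symmetric])
  qed
  have u_nonneg: "0 \<le> u k j" if "j < n" for k j
    using that
  proof (induction k arbitrary: j)
    case 0
    then show ?case by (simp add: u_0)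
  next
    case (Suc k)
    have "0 \<le> r * u (Suc k) j"
      using Suc nonneg by (subst u_Suc[symmetric]) (auto intro!: sum_nonneg mult_nonneg_nonneg)
    then show ?case using r0 by (simp add: zero_le_mult_iff)
  qed
  have "(\<lambda>k. (real n * C) * (r' / r) ^ k) \<longlonglongrightarrow> (real n * C) * 0"
    using r'0 r0 r'(2) by (intro tendsto_mult tendsto_const LIMSEQ_realpow_zero) auto
  then have "\<forall>\<^sub>F k in sequentially. (real n * C) * (r' / r) ^ k < 1"
    by (intro order_tendstoD(2)) auto
  then obtain N0 where N0: "\<And>N. N \<ge> N0 \<Longrightarrow> (real n * C) * (r' / r) ^ N < 1"
    unfolding eventually_sequentially by blast
  \<comment> \<open>The partial sum must contain \<open>u\<^sub>0 = 1\<close>, so it must not be empty.\<close>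
  define N where "N = Suc N0"
  have "N > 0" and N: "(real n * C) * (r' / r) ^ N < 1"
    using N0[of N] by (auto simp: N_def)
  have u_N: "u N j \<le> 1" if "j < n" for j
  proof -
    have "(\<Sum>i<n. (A ^\<^sub>m N) $$ (i, j)) \<le> (\<Sum>i<n. C * r' ^ N)"
      using entry that by (intro sum_mono) (metis abs_le_D1 lessThan_iff)
    then have "u N j \<le> (real n * (C * r' ^ N)) / r ^ N"
      unfolding u_def using r0 by (intro divide_right_mono) auto
    also have "\<dots> = (real n * C) * (r' / r) ^ N" by (simp add: power_divide)
    finally show ?thesis using N by simp
  qed
  define v where "v j = (\<Sum>k<N. u k j)" for j
  have "1 \<le> v j \<and> (\<Sum>i<n. v i * A $$ (i, j)) \<le> r * v j" if j: "j < n" for j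
  proof
    have "u 0 j \<le> v j"
      unfolding v_def using \<open>N > 0\<close> u_nonneg j by (intro member_le_sum) auto
    then show "1 \<le> v j" using u_0 j by simp
    have "(\<Sum>i<n. v i * A $$ (i, j)) = (\<Sum>k<N. \<Sum>i<n. u k i * A $$ (i, j))"
      unfolding v_def sum_distrib_right by (rule sum.swap)
    also have "\<dots> = r * (\<Sum>k<N. u (Suc k) j)"
      using j by (simp add: u_Suc sum_distrib_left)
    also have "(\<Sum>k<N. u (Suc k) j) = v j + (u N j - u 0 j)"
      using sum_lessThan_telescope[of "\<lambda>k. u k j" N] by (simp add: v_def sum_subtractf)
    also have "r * \<dots> \<le> r * v j"
      using u_N[OF j] u_0[OF j] r0 by (intro mult_left_mono) auto
    finally show "(\<Sum>i<n. v i * A $$ (i, j)) \<le> r * v j" .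
  qed
  then show ?thesis by blast
qed

section \<open>Decay under a delayed contraction\<close>

text \<open>
  One step gains the factor \<open>q\<close> over the worst of the last \<open>T\<close> values.  A bound that decreases by the
  factor \<open>root T q\<close> per step falls by exactly the factor \<open>q\<close> over \<open>T\<close> steps, so it propagates by induction.
\<close>

lemma delayed_contraction_decays:
  fixes D :: "nat \<Rightarrow> nat \<Rightarrow> real"
  assumes T: "T \<ge> 1" and q: "0 < q" "q < 1" and v: "\<And>i. i < n \<Longrightarrow> 0 < v i"
    and step: "\<And>m M. T \<le> m \<Longrightarrow> (\<And>d i. d < T \<Longrightarrow> i < n \<Longrightarrow> D (m - Suc d) i \<le> M * v i) \<Longrightarrow>
       (\<And>i. i < n \<Longrightarrow> D m i \<le> q * M * v i)"
  shows "\<exists>K. \<forall>m. \<forall>i<n. D m i \<le> K * root T q ^ m * v i"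
proof -
  define s where "s = root T q"
  have s: "0 < s" "s \<le> 1" and sT: "s ^ T = q"
    using T q by (auto simp: s_def)
  define K where "K = (\<Sum>m<T. \<Sum>i<n. \<bar>D m i\<bar> / (s ^ m * v i))"
  have K0: "0 \<le> K"
    unfolding K_def using s v by (intro sum_nonneg divide_nonneg_pos) auto
  have "D m i \<le> K * s ^ m * v i" if "i < n" for m i
    using that
  proof (induction m arbitrary: i rule: less_induct)
    case (less m)
    show ?case
    proof (cases "m < T")
      case True
      have pos: "0 < s ^ m * v i" using s v less.prems by simp
      have "\<bar>D m i\<bar> / (s ^ m * v i) \<le> (\<Sum>i<n. \<bar>D m i\<bar> / (s ^ m * v i))"
        using s v less.prems by (intro member_le_sum divide_nonneg_pos) auto
      also have "\<dots> \<le> K"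
        unfolding K_def using s v True
        by (intro member_le_sum[where f = "\<lambda>m. \<Sum>i<n. \<bar>D m i\<bar> / (s ^ m * v i)"]
              sum_nonneg divide_nonneg_pos) auto
      finally have "\<bar>D m i\<bar> \<le> K * (s ^ m * v i)"
        using pos by (simp add: pos_divide_le_eq)
      then show ?thesis by (simp add: mult.assoc)
    next
      case False
      have "D (m - Suc d) j \<le> (K * s ^ (m - T)) * v j" if "d < T" "j < n" for d j
      proof -
        have "D (m - Suc d) j \<le> K * s ^ (m - Suc d) * v j"
          using less.IH that False by simp
        also have "\<dots> \<le> (K * s ^ (m - T)) * v j"
          using s K0 v that
          by (intro mult_right_mono mult_left_mono power_decreasing) (auto intro: less_imp_le)
        finally show ?thesis .
      qed
      then have "D m i \<le> q * (K * s ^ (m - T)) * v i"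
        using False less.prems by (intro step) auto
      also have "q * (K * s ^ (m - T)) = K * s ^ m"
        using False by (simp add: sT[symmetric] power_add[symmetric] mult.left_commute)
      finally show ?thesis .
    qed
  qed
  then show ?thesis unfolding s_def by blast
qed

section \<open>The Cohen-Grossberg network\<close>

text \<open>
  The leakage term contributes \<open>|1 - \<epsilon>| M v\<^sub>j\<close> to the difference, and by the Lipschitz condition the
  coupling contributes at most \<open>L M\<close> times entry \<open>j\<close> of \<open>v |W|\<close>, which is at most \<open>L M r v\<^sub>j\<close> by the
  choice of \<open>v\<close>.
\<close>

lemma cohen_grossberg_contracts:
  assumes v: "\<And>i. i < n \<Longrightarrow> 0 < v i" and L: "L \<ge> 0"
    and lip: "\<And>i. i < n \<Longrightarrow> L-lipschitz_on UNIV (\<phi> i)"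
    and delay: "\<And>i j. i < n \<Longrightarrow> j < n \<Longrightarrow> \<tau> i j < T"
    and weight: "\<And>j. j < n \<Longrightarrow> (\<Sum>i<n. v i * \<bar>W $$ (i, j)\<bar>) \<le> r * v j"
    and q: "\<bar>1 - \<epsilon>\<bar> + L * r \<le> q" and M: "0 \<le> M"
    and close: "\<And>d i. d < T \<Longrightarrow> i < n \<Longrightarrow> \<bar>(xs ! d) $ i - (ys ! d) $ i\<bar> \<le> M * v i"
    and j: "j < n"
  shows "\<bar>cohen_grossberg n \<epsilon> W \<tau> \<phi> c xs $ j - cohen_grossberg n \<epsilon> W \<tau> \<phi> c ys $ j\<bar> \<le> q * M * v j"
proof -
  let ?x = "\<lambda>i. (xs ! \<tau> i j) $ i" and ?y = "\<lambda>i. (ys ! \<tau> i j) $ i"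
  have cl: "\<bar>?x i - ?y i\<bar> \<le> M * v i" if "i < n" for i
    using close delay j that by simp
  have term_le: "\<bar>W $$ (i, j) * (\<phi> i (?x i) - \<phi> i (?y i))\<bar> \<le> L * M * (v i * \<bar>W $$ (i, j)\<bar>)"
    if i: "i < n" for i
  proof -
    have "\<bar>\<phi> i (?x i) - \<phi> i (?y i)\<bar> \<le> L * \<bar>?x i - ?y i\<bar>"
      using lipschitz_onD[OF lip[OF i], of "?x i" "?y i"] by (simp add: dist_real_def)
    also have "\<dots> \<le> L * (M * v i)" using cl[OF i] L by (intro mult_left_mono)
    finally have "\<bar>W $$ (i, j)\<bar> * \<bar>\<phi> i (?x i) - \<phi> i (?y i)\<bar> \<le> \<bar>W $$ (i, j)\<bar> * (L * (M * v i))"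
      by (intro mult_left_mono) auto
    then show ?thesis by (simp add: abs_mult ac_simps)
  qed
  have "cohen_grossberg n \<epsilon> W \<tau> \<phi> c xs $ j - cohen_grossberg n \<epsilon> W \<tau> \<phi> c ys $ j
      = (1 - \<epsilon>) * (?x j - ?y j) + (\<Sum>i<n. W $$ (i, j) * (\<phi> i (?x i) - \<phi> i (?y i)))"
    using j by (simp add: cohen_grossberg_def algebra_simps sum_subtractf)
  also have "\<bar>\<dots>\<bar> \<le> \<bar>1 - \<epsilon>\<bar> * \<bar>?x j - ?y j\<bar> + (\<Sum>i<n. \<bar>W $$ (i, j) * (\<phi> i (?x i) - \<phi> i (?y i))\<bar>)"
    by (rule order_trans[OF abs_triangle_ineq]) (intro add_mono sum_abs, simp add: abs_mult)
  also have "\<dots> \<le> \<bar>1 - \<epsilon>\<bar> * (M * v j) + (\<Sum>i<n. L * M * (v i * \<bar>W $$ (i, j)\<bar>))"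
    using cl[OF j] term_le by (intro add_mono mult_left_mono sum_mono) auto
  also have "\<dots> \<le> \<bar>1 - \<epsilon>\<bar> * (M * v j) + L * M * (r * v j)"
    using weight[OF j] L M
    by (simp add: sum_distrib_left[symmetric] mult_left_mono)
  also have "\<dots> = (\<bar>1 - \<epsilon>\<bar> + L * r) * (M * v j)" by (simp add: algebra_simps)
  also have "\<dots> \<le> q * (M * v j)"
    using q M v[OF j] by (intro mult_right_mono) auto
  finally show ?thesis by (simp add: mult.assoc)
qed

text \<open>
  The iterates of \<open>x \<mapsto> H (x, \<dots>, x)\<close> have geometrically decreasing increments by the contraction
  property, so each coordinate converges; the limit is fixed because the network is continuous.
\<close>

lemma cohen_grossberg_has_fixed_point:
  assumes v: "\<And>i. i < n \<Longrightarrow> 0 < v i" and L: "L \<ge> 0" and T: "T \<ge> 1"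
    and lip: "\<And>i. i < n \<Longrightarrow> L-lipschitz_on UNIV (\<phi> i)"
    and delay: "\<And>i j. i < n \<Longrightarrow> j < n \<Longrightarrow> \<tau> i j < T"
    and weight: "\<And>j. j < n \<Longrightarrow> (\<Sum>i<n. v i * \<bar>W $$ (i, j)\<bar>) \<le> r * v j"
    and q: "\<bar>1 - \<epsilon>\<bar> + L * r \<le> q" "0 < q" "q < 1"
  shows "\<exists>p. p \<in> carrier_vec n \<and> p = cohen_grossberg n \<epsilon> W \<tau> \<phi> c (replicate T p)"
proof -
  define F where "F x = cohen_grossberg n \<epsilon> W \<tau> \<phi> c (replicate T x)" for x
  have F: "F x $ j = (1 - \<epsilon>) * x $ j + (\<Sum>i<n. W $$ (i, j) * \<phi> i (x $ i)) + c $ j"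
    if "j < n" for x j
    using that delay by (auto simp: F_def cohen_grossberg_def)
  define X where "X m = (F ^^ m) (0\<^sub>v n)" for m
  have X_Suc: "X (Suc m) = F (X m)" for m by (simp add: X_def)
  have "\<exists>K. \<forall>m. \<forall>i<n. \<bar>X (Suc m) $ i - X m $ i\<bar> \<le> K * root 1 q ^ m * v i"
  proof (rule delayed_contraction_decays)
    fix m :: nat and M :: real and i
    assume m: "1 \<le> m" and i: "i < n"
      and "\<And>d i. d < 1 \<Longrightarrow> i < n \<Longrightarrow> \<bar>X (Suc (m - Suc d)) $ i - X (m - Suc d) $ i\<bar> \<le> M * v i"
    then have prev: "\<bar>X m $ i - X (m - 1) $ i\<bar> \<le> M * v i" if "i < n" for i
      using that by fastforce
    have M: "0 \<le> M" using prev[OF i] v[OF i]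
      by (meson abs_ge_zero order_trans zero_le_mult_iff not_le)
    have "\<bar>F (X m) $ i - F (X (m - 1)) $ i\<bar> \<le> q * M * v i"
      unfolding F_def
      by (rule cohen_grossberg_contracts[where L = L and r = r and T = T])
         (use assms M i prev in auto)
    moreover have "F (X (m - 1)) = X m" using X_Suc[of "m - 1"] m by simp
    ultimately show "\<bar>X (Suc m) $ i - X m $ i\<bar> \<le> q * M * v i" by (simp add: X_Suc)
  qed (use q v in auto)
  then obtain K where K: "\<And>m i. i < n \<Longrightarrow> \<bar>X (Suc m) $ i - X m $ i\<bar> \<le> K * q ^ m * v i"
    by auto
  have "\<exists>l. (\<lambda>m. X m $ i) \<longlonglongrightarrow> l" if i: "i < n" for i
  proof -
    have "summable (\<lambda>m. K * q ^ m * v i)"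
      using q by (intro summable_mult summable_mult2 summable_geometric) auto
    then have "summable (\<lambda>m. X (Suc m) $ i - X m $ i)"
      by (rule summable_comparison_test[rotated]) (use K i in auto)
    then have "convergent (\<lambda>m. \<Sum>k<m. X (Suc k) $ i - X k $ i)"
      by (simp add: summable_iff_convergent)
    then have "convergent (\<lambda>m. X m $ i - X 0 $ i)"
      by (simp add: sum_lessThan_telescope[of "\<lambda>k. X k $ i"])
    then show ?thesis by (simp add: convergent_diff_const_right_iff convergent_def[symmetric])
  qed
  then obtain l where l: "\<And>i. i < n \<Longrightarrow> (\<lambda>m. X m $ i) \<longlonglongrightarrow> l i" by metis
  define p where "p = vec n l"
  have lp: "(\<lambda>m. X m $ i) \<longlonglongrightarrow> p $ i" if "i < n" for i
    using l that by (simp add: p_def)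
  have "p $ j = F p $ j" if j: "j < n" for j
  proof (rule LIMSEQ_unique)
    show "(\<lambda>m. X (Suc m) $ j) \<longlonglongrightarrow> p $ j"
      using lp[OF j] by (rule LIMSEQ_Suc)
    have "isCont (\<phi> i) y" if "i < n" for i y
      using lipschitz_on_continuous_on[OF lip[OF that]] by (simp add: continuous_on_eq_continuous_at)
    then show "(\<lambda>m. X (Suc m) $ j) \<longlonglongrightarrow> F p $ j"
      unfolding X_Suc F[OF j] using lp j
      by (intro tendsto_intros isCont_tendsto_compose[where g = "\<phi> _"]) auto
  qed
  moreover have "p \<in> carrier_vec n" "F p \<in> carrier_vec n"
    by (auto simp: p_def F_def cohen_grossberg_def)
  ultimately have "p = F p" by (intro eq_vecI) auto
  then show ?thesis using \<open>p \<in> carrier_vec n\<close> unfolding F_def by blast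
qed

theorem theorem4p5:
  fixes n T :: nat and \<epsilon> L :: real and c :: "real vec" and W :: "real mat"
    and \<tau> :: "nat \<Rightarrow> nat \<Rightarrow> nat" and \<phi> :: "nat \<Rightarrow> real \<Rightarrow> real"
  assumes "n \<ge> 1" and "T \<ge> 1" and "\<epsilon> \<noteq> 1"
    and "c \<in> carrier_vec n" and "W \<in> carrier_mat n n"
    and "\<And>i j. i < n \<Longrightarrow> j < n \<Longrightarrow> \<tau> i j \<le> T - 1"
    and "L \<ge> 0"
    and "\<And>i. i < n \<Longrightarrow> smooth (\<phi> i)"
    and "\<And>i. i < n \<Longrightarrow> L-lipschitz_on UNIV (\<phi> i)"
    and "\<bar>1 - \<epsilon>\<bar> + L * spectral_radius (map_mat complex_of_real (abs_mat W)) < 1"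
  shows "\<exists>p. globally_attracting_fixed_point n T (cohen_grossberg n \<epsilon> W \<tau> \<phi> c) p"
proof -
  let ?H = "cohen_grossberg n \<epsilon> W \<tau> \<phi> c"
  let ?sr = "spectral_radius (map_mat complex_of_real (abs_mat W))"
  have A: "abs_mat W \<in> carrier_mat n n" using assms(5) by (simp add: abs_mat_def)
  have delay: "\<tau> i j < T" if "i < n" "j < n" for i j
    using assms(6)[OF that] assms(2) by simp
  \<comment> \<open>Room above the spectral radius: adding \<open>\<delta>\<close> to it costs at most half of the gap below \<open>1\<close>.\<close>
  define gap where "gap = 1 - (\<bar>1 - \<epsilon>\<bar> + L * ?sr)"
  define \<delta> where "\<delta> = gap / (2 * (L + 1))"
  have gap: "0 < gap" using assms(10) by (simp add: gap_def)
  have \<delta>: "0 < \<delta>" using gap assms(7) by (simp add: \<delta>_def)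
  have "L * \<delta> \<le> gap / 2"
    using gap assms(7) by (simp add: \<delta>_def field_simps)
  moreover define r where "r = ?sr + \<delta>"
  moreover define q where "q = 1 - gap / 2"
  moreover have "\<bar>1 - \<epsilon>\<bar> + L * ?sr = 1 - gap" by (simp add: gap_def)
  ultimately have q: "\<bar>1 - \<epsilon>\<bar> + L * r \<le> q"
    by (simp only: distrib_left)
  have q1: "q < 1" using gap by (simp add: q_def)
  have "0 \<le> ?sr"
    using spectral_radius_mem_max(1)[of "map_mat complex_of_real (abs_mat W)" n] A assms(1) by auto
  then have "0 \<le> L * ?sr" using assms(7) by (rule mult_nonneg_nonneg[rotated])
  then have "gap \<le> 1" by (simp add: gap_def)
  then have q0: "0 < q" by (simp add: q_def)
  have "?sr < r" using \<delta> by (simp add: r_def)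
  then obtain v where v: "\<And>j. j < n \<Longrightarrow> 1 \<le> v j"
    and "\<And>j. j < n \<Longrightarrow> (\<Sum>i<n. v i * abs_mat W $$ (i, j)) \<le> r * v j"
    using positive_subinvariant_weight[OF A, of r] assms(1,5) by (auto simp: abs_mat_def)
  then have weight: "(\<Sum>i<n. v i * \<bar>W $$ (i, j)\<bar>) \<le> r * v j" if "j < n" for j
    using that assms(5) by (auto simp: abs_mat_def)
  have v0: "0 < v i" if "i < n" for i using v[OF that] by simp
  obtain p where p: "p \<in> carrier_vec n" "p = ?H (replicate T p)"
  proof -
    have "\<exists>p. p \<in> carrier_vec n \<and> p = ?H (replicate T p)"
      by (rule cohen_grossberg_has_fixed_point[where v = v and L = L and r = r and q = q])
         (fact v0 assms(7) assms(2) assms(9) delay weight q q0 q1)+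
    then show ?thesis using that by blast
  qed
  have "(\<lambda>k. MAX i\<in>{..<n}. \<bar>x (int k) $ i - p $ i\<bar>) \<longlonglongrightarrow> 0" if orbit: "is_orbit T ?H ini x" for ini x
  proof -
    \<comment> \<open>Shift time by \<open>T - 1\<close> so that the orbit, including its initial history, starts at \<open>0\<close>.\<close>
    define D where "D m i = \<bar>x (int m - int (T - 1)) $ i - p $ i\<bar>" for m i
    have "\<exists>K. \<forall>m. \<forall>i<n. D m i \<le> K * root T q ^ m * v i"
    proof (rule delayed_contraction_decays)
      fix m :: nat and M :: real and i
      assume m: "T \<le> m" and i: "i < n"
        and prev: "\<And>d i. d < T \<Longrightarrow> i < n \<Longrightarrow> D (m - Suc d) i \<le> M * v i"
      define k where "k = int m - int T"
      define hist where "hist = map (\<lambda>d. x (k - int d)) [0..<T]"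
      have k: "int m - int (T - 1) = k + 1" "0 \<le> k"
        using m assms(2) by (auto simp: k_def of_nat_diff)
      have "0 \<le> D (m - Suc 0) i" by (simp add: D_def)
      also have "\<dots> \<le> M * v i" using prev[of 0 i] i assms(2) by simp
      finally have M: "0 \<le> M" using v0[OF i] by (simp add: zero_le_mult_iff)
      have close: "\<bar>(hist ! d) $ i - (replicate T p ! d) $ i\<bar> \<le> M * v i"
        if "d < T" "i < n" for d i
      proof -
        have "int (m - Suc d) - int (T - 1) = k - int d"
          using that m by (simp add: k_def of_nat_diff)
        then show ?thesis using prev[OF that] that by (simp add: D_def hist_def)
      qed
      have "\<bar>?H hist $ i - ?H (replicate T p) $ i\<bar> \<le> q * M * v i"
        by (rule cohen_grossberg_contracts[where L = L and r = r and T = T])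
           (fact v0 assms(7) assms(9) delay weight q M close i)+
      moreover have "x (k + 1) = ?H hist"
        using orbit k(2) unfolding is_orbit_def hist_def by blast
      ultimately show "D m i \<le> q * M * v i"
        unfolding D_def k(1) using p(2)[symmetric] by simp
    qed (use assms(2) q0 q1 v0 in auto)
    then obtain K where K: "\<And>m i. i < n \<Longrightarrow> D m i \<le> K * root T q ^ m * v i" by blast
    define s where "s = root T q"
    have s: "0 < s" "s < 1" using assms(2) q0 q1 by (auto simp: s_def)
    have "D m i \<le> \<bar>K\<bar> * s ^ m * (\<Sum>i<n. v i)" if "i < n" for m i
    proof -
      have v_le: "v i \<le> (\<Sum>i<n. v i)"
        using v0 that by (intro member_le_sum) (auto intro: less_imp_le)
      have "D m i \<le> K * s ^ m * v i" using K[OF that] by (simp add: s_def)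
      also have "\<dots> \<le> \<bar>K\<bar> * s ^ m * v i"
        using s v0[OF that] by (intro mult_right_mono) auto
      also have "\<dots> \<le> \<bar>K\<bar> * s ^ m * (\<Sum>i<n. v i)"
        using s v_le by (intro mult_left_mono) auto
      finally show ?thesis .
    qed
    from this[of _ "k + (T - 1)" for k]
    have bound: "\<bar>x (int k) $ i - p $ i\<bar> \<le> \<bar>K\<bar> * s ^ (k + (T - 1)) * (\<Sum>i<n. v i)"
      if "i < n" for i k using that by (simp add: D_def)
    have ne: "(\<lambda>i. \<bar>x (int k) $ i - p $ i\<bar>) ` {..<n} \<noteq> {}" for k
      using assms(1) by (auto simp: lessThan_empty_iff)
    have "norm (MAX i\<in>{..<n}. \<bar>x (int k) $ i - p $ i\<bar>)
        \<le> \<bar>K\<bar> * s ^ (k + (T - 1)) * (\<Sum>i<n. v i)" for k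
    proof -
      have "0 \<le> (MAX i\<in>{..<n}. \<bar>x (int k) $ i - p $ i\<bar>)"
        using assms(1) ne by (subst Max_ge_iff) auto
      moreover have "(MAX i\<in>{..<n}. \<bar>x (int k) $ i - p $ i\<bar>)
          \<le> \<bar>K\<bar> * s ^ (k + (T - 1)) * (\<Sum>i<n. v i)"
        using ne bound by (subst Max_le_iff) auto
      ultimately show ?thesis by simp
    qed
    then have dominated: "\<forall>\<^sub>F k in sequentially. norm (MAX i\<in>{..<n}. \<bar>x (int k) $ i - p $ i\<bar>)
        \<le> \<bar>K\<bar> * s ^ (k + (T - 1)) * (\<Sum>i<n. v i)"
      by (intro always_eventually allI)
    have "(\<lambda>k. \<bar>K\<bar> * s ^ (k + (T - 1)) * (\<Sum>i<n. v i)) \<longlonglongrightarrow> \<bar>K\<bar> * 0 * (\<Sum>i<n. v i)"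
      using s by (intro tendsto_mult tendsto_const LIMSEQ_ignore_initial_segment LIMSEQ_realpow_zero) auto
    then have "(\<lambda>k. \<bar>K\<bar> * s ^ (k + (T - 1)) * (\<Sum>i<n. v i)) \<longlonglongrightarrow> 0" by simp
    then show ?thesis by (rule Lim_null_comparison[OF dominated])
  qed
  then show ?thesis
    using p unfolding globally_attracting_fixed_point_def by blast
qed

end
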